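(* Let $\mathfrak L$ be a (strictly described) 2-Puppe-exact $\mathrm{Gpd}^\ast$-category (à la Dupont). Then $\mathfrak L$ is weakly Puppe 2-exact.
   Context: Whiskering is written by juxtaposition. (Strictly described) $\mathrm{Gpd}^\ast$-category, i.e. category enriched over pointed groupoids: a strict 2-category in which all 2-cells are invertible, with a chosen zero morphism $0=0_{A,B}\colon A\to B$ for all $A,B$, such that $g\circ0=0$ and $0\circ f=0$ for all morphisms $f,g$, and whiskering any 2-cell with a zero morphism gives the identity $1_0$. A zero object is an object $0$ such that all hom-groupoids $\mathfrak L(A,0)$ and $\mathfrak L(0,A)$ are equivalent to the terminal category. In this setting the null morphisms are the zero morphisms $0_{A,B}$ and the null 2-cells are the identities $1_0$ of zero morphisms (the 2-ideal $(0)$). 2-kernels: a 2-kernel of $f\colon A\to B$ is $k\colon K\to A$ with a 2-cell $\alpha\colon fk\Rightarrow 0$ such that (1) for every $z\colon Z\to A$ and $\beta\colon fz\Rightarrow 0$ there are $u\colon Z\to K$ and $\gamma\colon z\Rightarrow ku$ with $\beta=(\alpha u)\circ(f\gamma)$; (2) for all $u,v\colon Z\to K$ and $\lambda\colon ku\Rightarrow kv$ with $(\alpha v)\circ(f\lambda)=\alpha u$ there is a unique $\mu\colon u\Rightarrow v$ with $k\mu=\lambda$. 2-cokernels are dual. "$m$ is a 2-kernel of its 2-cokernel (with appropriate structure 2-cell)" means: if $c$ with $\beta\colon cm\Rightarrow 0$ is a 2-cokernel of $m$, then $m$ with $\beta$ is a 2-kernel of $c$; dually for 2-cokernels. $f\colon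 A\to B$ is 0-faithful if every 2-cell $\alpha\colon0\Rightarrow0\colon X\to A$ with $f\alpha=1_0$ equals $1_0$; it is fully 0-faithful if for every $a\colon X\to A$ and $\beta\colon fa\Rightarrow0$ there is a unique $\alpha\colon a\Rightarrow0$ with $f\alpha=\beta$. 0-cofaithful and fully 0-cofaithful are dual. Pip: the pip of $f\colon A\to B$ is a universal 2-cell $\pi\colon0\Rightarrow0\colon \mathrm{Pip}f\to A$ with $f\pi=1_0$: every $\alpha\colon0\Rightarrow0\colon X\to A$ with $f\alpha=1_0$ is $\pi x$ for some $x\colon X\to\mathrm{Pip}f$, and if $\pi x=\pi x'$ there is a unique 2-cell $x\Rightarrow x'$. Copip is dual (a universal $\rho\colon0\Rightarrow0\colon B\to\mathrm{Copip}f$ with $\rho f=1_0$). Root: a root of $\pi\colon0\Rightarrow0\colon A\to B$ is $r\colon R\to A$ with $\pi r=1_0$ such that every $x\colon X\to A$ with $\pi x=1_0$ is isomorphic to $rx'$ for some $x'\colon X\to R$, and for all $x,x'\colon X\to R$ and $\lambda\colon rx\Rightarrow rx'$ there is a unique $\mu\colon x\Rightarrow x'$ with $r\mu=\lambda$. Coroot is dual. 2-Puppe-exact $\mathrm{Gpd}^\ast$-category (à la Dupont): a $\mathrm{Gpd}^\ast$-category with a zero object such that (i) all 2-kernels and 2-cokernels exist; (ii) every 0-faithful morphism is a 2-kernel of its 2-cokernel, and dually every 0-cofaithful morphism is a 2-cokernel of its 2-kernel (with appropriate structure 2-cells); (iii) every fully 0-faithful morphism is (canonically) a root of its copip, and dually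 every fully 0-cofaithful morphism is a coroot of its pip. Weakly Puppe 2-exact: all 2-kernels and 2-cokernels exist; the 2-ideal $(0)$ is weakly closed, i.e. for every 2-kernel $(k,\alpha)$ of $f$: for all $s$ and $\delta\colon ks\Rightarrow0$ with $f\delta=\alpha s$ there is $\psi\colon s\Rightarrow 0$ with $k\psi=\delta$, and every 2-cell $\mu\colon0\Rightarrow0$ with $k\mu=1_0$ equals $1_0$, together with the dual conditions for 2-cokernels; every 2-kernel is a 2-kernel of its 2-cokernel and every 2-cokernel is a 2-cokernel of its 2-kernel (with appropriate structure 2-cells); every morphism is isomorphic, via an invertible 2-cell, to a composite of a 2-cokernel followed by a 2-kernel. *)

theory Defs
  imports Main
begin

section \<open>Categories enriched over pointed groupoids\<close>

text \<open>
  Objects, morphisms and 2-cells of a strict 2-category with chosen zero morphisms.  Values of the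
  operations outside the carriers, or on non-composable arguments, are unconstrained.
  Both compositions are written in applicative order (the right factor comes first).
\<close>

record ('o, 'm, 'c) pointed_two_cat =
  Obj :: "'o set"
  Mor :: "'m set"
  Dom :: "'m \<Rightarrow> 'o"
  Cod :: "'m \<Rightarrow> 'o"
  Id1 :: "'o \<Rightarrow> 'm"
  Comp :: "'m \<Rightarrow> 'm \<Rightarrow> 'm"  (infixl "\<cdot>\<index>" 75)
  Cell :: "'c set"
  Src :: "'c \<Rightarrow> 'm"
  Trg :: "'c \<Rightarrow> 'm"
  Id2 :: "'m \<Rightarrow> 'c"
  VComp :: "'c \<Rightarrow> 'c \<Rightarrow> 'c"  (infixl "\<bullet>\<index>" 65)
  HComp :: "'c \<Rightarrow> 'c \<Rightarrow> 'c"  (infixl "\<star>\<index>" 75)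
  Zero :: "'o \<Rightarrow> 'o \<Rightarrow> 'm"

definition hom1 :: "('o, 'm, 'c, 'x) pointed_two_cat_scheme \<Rightarrow> 'o \<Rightarrow> 'o \<Rightarrow> 'm set" where
  "hom1 L A B = {f \<in> Mor L. Dom L f = A \<and> Cod L f = B}"

definition hom2 :: "('o, 'm, 'c, 'x) pointed_two_cat_scheme \<Rightarrow> 'm \<Rightarrow> 'm \<Rightarrow> 'c set" where
  "hom2 L f g = {\<alpha> \<in> Cell L. Src L \<alpha> = f \<and> Trg L \<alpha> = g}"

definition lwhisker :: "('o, 'm, 'c, 'x) pointed_two_cat_scheme \<Rightarrow> 'm \<Rightarrow> 'c \<Rightarrow> 'c"
    (infixl "\<rhd>\<index>" 75)
  where "g \<rhd>\<^bsub>L\<^esub> \<alpha> = Id2 L g \<star>\<^bsub>L\<^esub> \<alpha>"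

definition rwhisker :: "('o, 'm, 'c, 'x) pointed_two_cat_scheme \<Rightarrow> 'c \<Rightarrow> 'm \<Rightarrow> 'c"
    (infixl "\<lhd>\<index>" 75)
  where "\<alpha> \<lhd>\<^bsub>L\<^esub> f = \<alpha> \<star>\<^bsub>L\<^esub> Id2 L f"

locale strict_two_category =
  fixes L :: "('o, 'm, 'c, 'x) pointed_two_cat_scheme" (structure)
  assumes Dom_Obj: "f \<in> Mor L \<Longrightarrow> Dom L f \<in> Obj L"
    and Cod_Obj: "f \<in> Mor L \<Longrightarrow> Cod L f \<in> Obj L"
    and Id1_hom: "A \<in> Obj L \<Longrightarrow> Id1 L A \<in> hom1 L A A"
    and Comp_hom: "\<lbrakk>f \<in> hom1 L A B; g \<in> hom1 L B C\<rbrakk> \<Longrightarrow> g \<cdot> f \<in> hom1 L A C"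
    and Comp_assoc: "\<lbrakk>f \<in> hom1 L A B; g \<in> hom1 L B C; h \<in> hom1 L C D\<rbrakk>
          \<Longrightarrow> (h \<cdot> g) \<cdot> f = h \<cdot> (g \<cdot> f)"
    and Comp_Id1: "f \<in> hom1 L A B \<Longrightarrow> f \<cdot> Id1 L A = f"
    and Id1_Comp: "f \<in> hom1 L A B \<Longrightarrow> Id1 L B \<cdot> f = f"
    and Src_Mor: "\<alpha> \<in> Cell L \<Longrightarrow> Src L \<alpha> \<in> Mor L"
    and Trg_Mor: "\<alpha> \<in> Cell L \<Longrightarrow> Trg L \<alpha> \<in> Mor L"
    and Dom_Trg: "\<alpha> \<in> Cell L \<Longrightarrow> Dom L (Trg L \<alpha>) = Dom L (Src L \<alpha>)"
    and Cod_Trg: "\<alpha> \<in> Cell L \<Longrightarrow> Cod L (Trg L \<alpha>) = Cod L (Src L \<alpha>)"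
    and Id2_hom: "f \<in> Mor L \<Longrightarrow> Id2 L f \<in> hom2 L f f"
    and VComp_hom: "\<lbrakk>\<alpha> \<in> hom2 L f g; \<beta> \<in> hom2 L g h\<rbrakk> \<Longrightarrow> \<beta> \<bullet> \<alpha> \<in> hom2 L f h"
    and VComp_assoc: "\<lbrakk>\<alpha> \<in> hom2 L f g; \<beta> \<in> hom2 L g h; \<gamma> \<in> hom2 L h i\<rbrakk>
          \<Longrightarrow> (\<gamma> \<bullet> \<beta>) \<bullet> \<alpha> = \<gamma> \<bullet> (\<beta> \<bullet> \<alpha>)"
    and VComp_Id2: "\<alpha> \<in> hom2 L f g \<Longrightarrow> \<alpha> \<bullet> Id2 L f = \<alpha>"
    and Id2_VComp: "\<alpha> \<in> hom2 L f g \<Longrightarrow> Id2 L g \<bullet> \<alpha> = \<alpha>"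
    and HComp_hom: "\<lbrakk>f \<in> hom1 L A B; g \<in> hom1 L B C; \<alpha> \<in> hom2 L f f'; \<beta> \<in> hom2 L g g'\<rbrakk>
          \<Longrightarrow> \<beta> \<star> \<alpha> \<in> hom2 L (g \<cdot> f) (g' \<cdot> f')"
    and HComp_assoc: "\<lbrakk>f \<in> hom1 L A B; g \<in> hom1 L B C; h \<in> hom1 L C D;
            \<alpha> \<in> hom2 L f f'; \<beta> \<in> hom2 L g g'; \<gamma> \<in> hom2 L h h'\<rbrakk>
          \<Longrightarrow> (\<gamma> \<star> \<beta>) \<star> \<alpha> = \<gamma> \<star> (\<beta> \<star> \<alpha>)"
    and HComp_Id: "\<lbrakk>f \<in> hom1 L A B; \<alpha> \<in> hom2 L f f'\<rbrakk> \<Longrightarrow> \<alpha> \<star> Id2 L (Id1 L A) = \<alpha>"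
    and Id_HComp: "\<lbrakk>f \<in> hom1 L A B; \<alpha> \<in> hom2 L f f'\<rbrakk> \<Longrightarrow> Id2 L (Id1 L B) \<star> \<alpha> = \<alpha>"
    and HComp_Id2: "\<lbrakk>f \<in> hom1 L A B; g \<in> hom1 L B C\<rbrakk>
          \<Longrightarrow> Id2 L g \<star> Id2 L f = Id2 L (g \<cdot> f)"
    and interchange: "\<lbrakk>f \<in> hom1 L A B; g \<in> hom1 L B C;
            \<alpha> \<in> hom2 L f f'; \<alpha>' \<in> hom2 L f' f''; \<beta> \<in> hom2 L g g'; \<beta>' \<in> hom2 L g' g''\<rbrakk>
          \<Longrightarrow> (\<beta>' \<bullet> \<beta>) \<star> (\<alpha>' \<bullet> \<alpha>) = (\<beta>' \<star> \<alpha>') \<bullet> (\<beta> \<star> \<alpha>)"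

locale gpd_star_category = strict_two_category L
  for L :: "('o, 'm, 'c, 'x) pointed_two_cat_scheme" (structure) +
  assumes Cell_invertible: "\<alpha> \<in> hom2 L f g
          \<Longrightarrow> \<exists>\<alpha>' \<in> hom2 L g f. \<alpha>' \<bullet> \<alpha> = Id2 L f \<and> \<alpha> \<bullet> \<alpha>' = Id2 L g"
    and Zero_hom: "\<lbrakk>A \<in> Obj L; B \<in> Obj L\<rbrakk> \<Longrightarrow> Zero L A B \<in> hom1 L A B"
    and Comp_Zero: "\<lbrakk>A \<in> Obj L; g \<in> hom1 L B C\<rbrakk> \<Longrightarrow> g \<cdot> Zero L A B = Zero L A C"
    and Zero_Comp: "\<lbrakk>C \<in> Obj L; f \<in> hom1 L A B\<rbrakk> \<Longrightarrow> Zero L B C \<cdot> f = Zero L A C"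
    and whisker_Zero: "\<lbrakk>A \<in> Obj L; g \<in> hom1 L B C; \<alpha> \<in> hom2 L g g'\<rbrakk>
          \<Longrightarrow> \<alpha> \<lhd> Zero L A B = Id2 L (Zero L A C)"
    and Zero_whisker: "\<lbrakk>C \<in> Obj L; f \<in> hom1 L A B; \<alpha> \<in> hom2 L f f'\<rbrakk>
          \<Longrightarrow> Zero L B C \<rhd> \<alpha> = Id2 L (Zero L A C)"

text \<open>Duality reverses the morphisms but not the 2-cells.\<close>

definition op_cat :: "('o, 'm, 'c, 'x) pointed_two_cat_scheme \<Rightarrow> ('o, 'm, 'c) pointed_two_cat" where
  "op_cat L =
    \<lparr>Obj = Obj L, Mor = Mor L, Dom = Cod L, Cod = Dom L, Id1 = Id1 L,
     Comp = (\<lambda>g f. f \<cdot>\<^bsub>L\<^esub> g), Cell = Cell L, Src = Src L, Trg = Trg L, Id2 = Id2 L,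
     VComp = VComp L, HComp = (\<lambda>\<beta> \<alpha>. \<alpha> \<star>\<^bsub>L\<^esub> \<beta>), Zero = (\<lambda>A B. Zero L B A)\<rparr>"

lemma op_cat_simps [simp]:
  "Obj (op_cat L) = Obj L" "Mor (op_cat L) = Mor L" "Dom (op_cat L) = Cod L"
  "Cod (op_cat L) = Dom L" "Id1 (op_cat L) = Id1 L" "g \<cdot>\<^bsub>op_cat L\<^esub> f = f \<cdot>\<^bsub>L\<^esub> g"
  "Cell (op_cat L) = Cell L" "Src (op_cat L) = Src L" "Trg (op_cat L) = Trg L"
  "Id2 (op_cat L) = Id2 L" "\<beta> \<bullet>\<^bsub>op_cat L\<^esub> \<alpha> = \<beta> \<bullet>\<^bsub>L\<^esub> \<alpha>" "\<beta> \<star>\<^bsub>op_cat L\<^esub> \<alpha> = \<alpha> \<star>\<^bsub>L\<^esub> \<beta>"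
  "Zero (op_cat L) A B = Zero L B A"
  "hom1 (op_cat L) A B = hom1 L B A" "hom2 (op_cat L) f g = hom2 L f g"
  "f \<rhd>\<^bsub>op_cat L\<^esub> \<alpha> = \<alpha> \<lhd>\<^bsub>L\<^esub> f" "\<alpha> \<lhd>\<^bsub>op_cat L\<^esub> f = f \<rhd>\<^bsub>L\<^esub> \<alpha>"
  by (auto simp: op_cat_def hom1_def hom2_def lwhisker_def rwhisker_def)

text \<open>
  The groupoid of morphisms from \<open>A\<close> to \<open>B\<close> is equivalent to the terminal category:
  the only functor to the terminal category has as pseudo-inverse the functor selecting some \<open>c\<close>,
  which means that there is a natural isomorphism \<open>\<eta>\<close> from the identity functor to the constant
  functor at \<open>c\<close>.  (The components of \<open>\<eta>\<close> are invertible because all 2-cells are; the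
  other composite of the two functors is the identity.)
\<close>

definition hom_equiv_terminal :: "('o, 'm, 'c, 'x) pointed_two_cat_scheme \<Rightarrow> 'o \<Rightarrow> 'o \<Rightarrow> bool" where
  "hom_equiv_terminal L A B \<longleftrightarrow>
    (\<exists>c \<in> hom1 L A B. \<exists>\<eta>.
      (\<forall>x \<in> hom1 L A B. \<eta> x \<in> hom2 L x c) \<and>
      (\<forall>x \<in> hom1 L A B. \<forall>y \<in> hom1 L A B. \<forall>\<kappa> \<in> hom2 L x y. \<eta> y \<bullet>\<^bsub>L\<^esub> \<kappa> = \<eta> x))"

definition zero_object :: "('o, 'm, 'c, 'x) pointed_two_cat_scheme \<Rightarrow> 'o \<Rightarrow> bool" where
  "zero_object L Z \<longleftrightarrow>
    Z \<in> Obj L \<and> (\<forall>A \<in> Obj L. hom_equiv_terminal L A Z \<and> hom_equiv_terminal L Z A)"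


section \<open>2-kernels and 2-cokernels\<close>

text \<open>The object \<open>K\<close> carrying the 2-kernel is \<open>Dom L k\<close>.\<close>

definition is_2kernel ::
  "('o, 'm, 'c, 'x) pointed_two_cat_scheme \<Rightarrow> 'm \<Rightarrow> 'm \<Rightarrow> 'c \<Rightarrow> bool" where
  "is_2kernel L f k \<alpha> \<longleftrightarrow>
    f \<in> Mor L \<and> k \<in> Mor L \<and> Cod L k = Dom L f \<and>
    \<alpha> \<in> hom2 L (f \<cdot> k) (Zero L (Dom L k) (Cod L f)) \<and>
    (\<forall>Z \<in> Obj L. \<forall>z \<in> hom1 L Z (Dom L f). \<forall>\<beta> \<in> hom2 L (f \<cdot> z) (Zero L Z (Cod L f)).
      \<exists>u \<in> hom1 L Z (Dom L k). \<exists>\<gamma> \<in> hom2 L z (k \<cdot> u). \<beta> = (\<alpha> \<lhd> u) \<bullet> (f \<rhd> \<gamma>)) \<and>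
    (\<forall>Z \<in> Obj L. \<forall>u \<in> hom1 L Z (Dom L k). \<forall>v \<in> hom1 L Z (Dom L k).
      \<forall>\<kappa> \<in> hom2 L (k \<cdot> u) (k \<cdot> v). (\<alpha> \<lhd> v) \<bullet> (f \<rhd> \<kappa>) = \<alpha> \<lhd> u \<longrightarrow>
        (\<exists>!\<mu>. \<mu> \<in> hom2 L u v \<and> k \<rhd> \<mu> = \<kappa>))"
  for L (structure)

definition is_2cokernel ::
  "('o, 'm, 'c, 'x) pointed_two_cat_scheme \<Rightarrow> 'm \<Rightarrow> 'm \<Rightarrow> 'c \<Rightarrow> bool" where
  "is_2cokernel L f c \<beta> \<longleftrightarrow> is_2kernel (op_cat L) f c \<beta>"

lemma is_2cokernel_iff:
  "is_2cokernel L f c \<beta> \<longleftrightarrow>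
    f \<in> Mor L \<and> c \<in> Mor L \<and> Dom L c = Cod L f \<and>
    \<beta> \<in> hom2 L (c \<cdot> f) (Zero L (Dom L f) (Cod L c)) \<and>
    (\<forall>Z \<in> Obj L. \<forall>z \<in> hom1 L (Cod L f) Z. \<forall>\<delta> \<in> hom2 L (z \<cdot> f) (Zero L (Dom L f) Z).
      \<exists>u \<in> hom1 L (Cod L c) Z. \<exists>\<gamma> \<in> hom2 L z (u \<cdot> c). \<delta> = (u \<rhd> \<beta>) \<bullet> (\<gamma> \<lhd> f)) \<and>
    (\<forall>Z \<in> Obj L. \<forall>u \<in> hom1 L (Cod L c) Z. \<forall>v \<in> hom1 L (Cod L c) Z.
      \<forall>\<kappa> \<in> hom2 L (u \<cdot> c) (v \<cdot> c). (v \<rhd> \<beta>) \<bullet> (\<kappa> \<lhd> f) = u \<rhd> \<beta> \<longrightarrow>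
        (\<exists>!\<mu>. \<mu> \<in> hom2 L u v \<and> \<mu> \<lhd> c = \<kappa>))"
  for L (structure)
  by (simp add: is_2cokernel_def is_2kernel_def)

definition has_2kernels :: "('o, 'm, 'c, 'x) pointed_two_cat_scheme \<Rightarrow> bool" where
  "has_2kernels L \<longleftrightarrow> (\<forall>f \<in> Mor L. \<exists>k \<alpha>. is_2kernel L f k \<alpha>)"

definition has_2cokernels :: "('o, 'm, 'c, 'x) pointed_two_cat_scheme \<Rightarrow> bool" where
  "has_2cokernels L \<longleftrightarrow> (\<forall>f \<in> Mor L. \<exists>c \<beta>. is_2cokernel L f c \<beta>)"

definition is_2kernel_of_its_2cokernel ::
  "('o, 'm, 'c, 'x) pointed_two_cat_scheme \<Rightarrow> 'm \<Rightarrow> bool" where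
  "is_2kernel_of_its_2cokernel L m \<longleftrightarrow> (\<forall>c \<beta>. is_2cokernel L m c \<beta> \<longrightarrow> is_2kernel L c m \<beta>)"

definition is_2cokernel_of_its_2kernel ::
  "('o, 'm, 'c, 'x) pointed_two_cat_scheme \<Rightarrow> 'm \<Rightarrow> bool" where
  "is_2cokernel_of_its_2kernel L e \<longleftrightarrow> (\<forall>k \<alpha>. is_2kernel L e k \<alpha> \<longrightarrow> is_2cokernel L k e \<alpha>)"


section \<open>0-faithful morphisms, pips and roots\<close>

definition zero_faithful :: "('o, 'm, 'c, 'x) pointed_two_cat_scheme \<Rightarrow> 'm \<Rightarrow> bool" where
  "zero_faithful L f \<longleftrightarrow>
    (\<forall>X \<in> Obj L. \<forall>\<alpha> \<in> hom2 L (Zero L X (Dom L f)) (Zero L X (Dom L f)).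
      f \<rhd> \<alpha> = Id2 L (Zero L X (Cod L f)) \<longrightarrow> \<alpha> = Id2 L (Zero L X (Dom L f)))"
  for L (structure)

definition fully_zero_faithful :: "('o, 'm, 'c, 'x) pointed_two_cat_scheme \<Rightarrow> 'm \<Rightarrow> bool" where
  "fully_zero_faithful L f \<longleftrightarrow>
    (\<forall>X \<in> Obj L. \<forall>a \<in> hom1 L X (Dom L f). \<forall>\<beta> \<in> hom2 L (f \<cdot> a) (Zero L X (Cod L f)).
      \<exists>!\<alpha>. \<alpha> \<in> hom2 L a (Zero L X (Dom L f)) \<and> f \<rhd> \<alpha> = \<beta>)"
  for L (structure)

definition zero_cofaithful :: "('o, 'm, 'c, 'x) pointed_two_cat_scheme \<Rightarrow> 'm \<Rightarrow> bool" where
  "zero_cofaithful L f \<longleftrightarrow> zero_faithful (op_cat L) f"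

definition fully_zero_cofaithful :: "('o, 'm, 'c, 'x) pointed_two_cat_scheme \<Rightarrow> 'm \<Rightarrow> bool" where
  "fully_zero_cofaithful L f \<longleftrightarrow> fully_zero_faithful (op_cat L) f"

lemma zero_cofaithful_iff:
  "zero_cofaithful L f \<longleftrightarrow>
    (\<forall>Y \<in> Obj L. \<forall>\<alpha> \<in> hom2 L (Zero L (Cod L f) Y) (Zero L (Cod L f) Y).
      \<alpha> \<lhd> f = Id2 L (Zero L (Dom L f) Y) \<longrightarrow> \<alpha> = Id2 L (Zero L (Cod L f) Y))"
  for L (structure)
  by (simp add: zero_cofaithful_def zero_faithful_def)

lemma fully_zero_cofaithful_iff:
  "fully_zero_cofaithful L f \<longleftrightarrow>
    (\<forall>Y \<in> Obj L. \<forall>b \<in> hom1 L (Cod L f) Y. \<forall>\<beta> \<in> hom2 L (b \<cdot> f) (Zero L (Dom L f) Y).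
      \<exists>!\<alpha>. \<alpha> \<in> hom2 L b (Zero L (Cod L f) Y) \<and> \<alpha> \<lhd> f = \<beta>)"
  for L (structure)
  by (simp add: fully_zero_cofaithful_def fully_zero_faithful_def)

definition is_pip ::
  "('o, 'm, 'c, 'x) pointed_two_cat_scheme \<Rightarrow> 'm \<Rightarrow> 'o \<Rightarrow> 'c \<Rightarrow> bool" where
  "is_pip L f P \<pi> \<longleftrightarrow>
    f \<in> Mor L \<and> P \<in> Obj L \<and>
    \<pi> \<in> hom2 L (Zero L P (Dom L f)) (Zero L P (Dom L f)) \<and>
    f \<rhd> \<pi> = Id2 L (Zero L P (Cod L f)) \<and>
    (\<forall>X \<in> Obj L. \<forall>\<alpha> \<in> hom2 L (Zero L X (Dom L f)) (Zero L X (Dom L f)).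
      f \<rhd> \<alpha> = Id2 L (Zero L X (Cod L f)) \<longrightarrow> (\<exists>x \<in> hom1 L X P. \<alpha> = \<pi> \<lhd> x)) \<and>
    (\<forall>X \<in> Obj L. \<forall>x \<in> hom1 L X P. \<forall>x' \<in> hom1 L X P.
      \<pi> \<lhd> x = \<pi> \<lhd> x' \<longrightarrow> (\<exists>!\<chi>. \<chi> \<in> hom2 L x x'))"
  for L (structure)

definition is_copip ::
  "('o, 'm, 'c, 'x) pointed_two_cat_scheme \<Rightarrow> 'm \<Rightarrow> 'o \<Rightarrow> 'c \<Rightarrow> bool" where
  "is_copip L f Q \<rho> \<longleftrightarrow> is_pip (op_cat L) f Q \<rho>"

lemma is_copip_iff:
  "is_copip L f Q \<rho> \<longleftrightarrow>
    f \<in> Mor L \<and> Q \<in> Obj L \<and>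
    \<rho> \<in> hom2 L (Zero L (Cod L f) Q) (Zero L (Cod L f) Q) \<and>
    \<rho> \<lhd> f = Id2 L (Zero L (Dom L f) Q) \<and>
    (\<forall>Y \<in> Obj L. \<forall>\<alpha> \<in> hom2 L (Zero L (Cod L f) Y) (Zero L (Cod L f) Y).
      \<alpha> \<lhd> f = Id2 L (Zero L (Dom L f) Y) \<longrightarrow> (\<exists>y \<in> hom1 L Q Y. \<alpha> = y \<rhd> \<rho>)) \<and>
    (\<forall>Y \<in> Obj L. \<forall>y \<in> hom1 L Q Y. \<forall>y' \<in> hom1 L Q Y.
      y \<rhd> \<rho> = y' \<rhd> \<rho> \<longrightarrow> (\<exists>!\<chi>. \<chi> \<in> hom2 L y y'))"
  for L (structure)
  by (simp add: is_copip_def is_pip_def)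

text \<open>
  \<open>is_root L A B \<pi> r\<close>: \<open>r\<close> is a root of the 2-cell \<open>\<pi>\<close> on the zero morphism from \<open>A\<close> to \<open>B\<close>;
  \<open>is_coroot L A B \<pi> r\<close> likewise, so here \<open>r\<close> has codomain \<open>A\<close>, respectively domain \<open>B\<close>.
\<close>

definition is_root ::
  "('o, 'm, 'c, 'x) pointed_two_cat_scheme \<Rightarrow> 'o \<Rightarrow> 'o \<Rightarrow> 'c \<Rightarrow> 'm \<Rightarrow> bool" where
  "is_root L A B \<pi> r \<longleftrightarrow>
    A \<in> Obj L \<and> B \<in> Obj L \<and> \<pi> \<in> hom2 L (Zero L A B) (Zero L A B) \<and>
    r \<in> Mor L \<and> Cod L r = A \<and>
    \<pi> \<lhd> r = Id2 L (Zero L (Dom L r) B) \<and>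
    (\<forall>X \<in> Obj L. \<forall>x \<in> hom1 L X A. \<pi> \<lhd> x = Id2 L (Zero L X B) \<longrightarrow>
      (\<exists>x' \<in> hom1 L X (Dom L r). \<exists>\<xi>. \<xi> \<in> hom2 L x (r \<cdot> x'))) \<and>
    (\<forall>X \<in> Obj L. \<forall>x \<in> hom1 L X (Dom L r). \<forall>x' \<in> hom1 L X (Dom L r).
      \<forall>\<kappa> \<in> hom2 L (r \<cdot> x) (r \<cdot> x'). \<exists>!\<mu>. \<mu> \<in> hom2 L x x' \<and> r \<rhd> \<mu> = \<kappa>)"
  for L (structure)

definition is_coroot ::
  "('o, 'm, 'c, 'x) pointed_two_cat_scheme \<Rightarrow> 'o \<Rightarrow> 'o \<Rightarrow> 'c \<Rightarrow> 'm \<Rightarrow> bool" where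
  "is_coroot L A B \<pi> r \<longleftrightarrow> is_root (op_cat L) B A \<pi> r"

lemma is_coroot_iff:
  "is_coroot L A B \<pi> r \<longleftrightarrow>
    A \<in> Obj L \<and> B \<in> Obj L \<and> \<pi> \<in> hom2 L (Zero L A B) (Zero L A B) \<and>
    r \<in> Mor L \<and> Dom L r = B \<and>
    r \<rhd> \<pi> = Id2 L (Zero L A (Cod L r)) \<and>
    (\<forall>Y \<in> Obj L. \<forall>y \<in> hom1 L B Y. y \<rhd> \<pi> = Id2 L (Zero L A Y) \<longrightarrow>
      (\<exists>y' \<in> hom1 L (Cod L r) Y. \<exists>\<xi>. \<xi> \<in> hom2 L y (y' \<cdot> r))) \<and>
    (\<forall>Y \<in> Obj L. \<forall>y \<in> hom1 L (Cod L r) Y. \<forall>y' \<in> hom1 L (Cod L r) Y.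
      \<forall>\<kappa> \<in> hom2 L (y \<cdot> r) (y' \<cdot> r). \<exists>!\<mu>. \<mu> \<in> hom2 L y y' \<and> \<mu> \<lhd> r = \<kappa>)"
  for L (structure)
  by (auto simp add: is_coroot_def is_root_def)

definition is_root_of_its_copip :: "('o, 'm, 'c, 'x) pointed_two_cat_scheme \<Rightarrow> 'm \<Rightarrow> bool" where
  "is_root_of_its_copip L f \<longleftrightarrow> (\<forall>Q \<rho>. is_copip L f Q \<rho> \<longrightarrow> is_root L (Cod L f) Q \<rho> f)"

definition is_coroot_of_its_pip :: "('o, 'm, 'c, 'x) pointed_two_cat_scheme \<Rightarrow> 'm \<Rightarrow> bool" where
  "is_coroot_of_its_pip L f \<longleftrightarrow> (\<forall>P \<pi>. is_pip L f P \<pi> \<longrightarrow> is_coroot L P (Dom L f) \<pi> f)"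


section \<open>The two notions of exactness\<close>

text \<open>
  No existence of pips and copips is assumed: they can be constructed from 2-kernels, 2-cokernels
  and a zero object.
\<close>

locale two_puppe_exact = gpd_star_category L
  for L :: "('o, 'm, 'c, 'x) pointed_two_cat_scheme" (structure) +
  assumes zero_object_exists: "\<exists>Z. zero_object L Z"
    and has_2kernels: "has_2kernels L"
    and has_2cokernels: "has_2cokernels L"
    and zero_faithful_2kernel:
      "\<lbrakk>f \<in> Mor L; zero_faithful L f\<rbrakk> \<Longrightarrow> is_2kernel_of_its_2cokernel L f"
    and zero_cofaithful_2cokernel:
      "\<lbrakk>f \<in> Mor L; zero_cofaithful L f\<rbrakk> \<Longrightarrow> is_2cokernel_of_its_2kernel L f"
    and fully_zero_faithful_root:
      "\<lbrakk>f \<in> Mor L; fully_zero_faithful L f\<rbrakk> \<Longrightarrow> is_root_of_its_copip L f"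
    and fully_zero_cofaithful_coroot:
      "\<lbrakk>f \<in> Mor L; fully_zero_cofaithful L f\<rbrakk> \<Longrightarrow> is_coroot_of_its_pip L f"

text \<open>The 2-ideal of zero morphisms and their identities is weakly closed: the half on 2-kernels.\<close>

definition zero_ideal_weakly_closed_kernels ::
  "('o, 'm, 'c, 'x) pointed_two_cat_scheme \<Rightarrow> bool" where
  "zero_ideal_weakly_closed_kernels L \<longleftrightarrow>
    (\<forall>f k \<alpha>. is_2kernel L f k \<alpha> \<longrightarrow>
      (\<forall>X \<in> Obj L. \<forall>s \<in> hom1 L X (Dom L k). \<forall>\<delta> \<in> hom2 L (k \<cdot> s) (Zero L X (Cod L k)).
        f \<rhd> \<delta> = \<alpha> \<lhd> s \<longrightarrow> (\<exists>\<psi> \<in> hom2 L s (Zero L X (Dom L k)). k \<rhd> \<psi> = \<delta>)) \<and>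
      (\<forall>X \<in> Obj L. \<forall>\<mu> \<in> hom2 L (Zero L X (Dom L k)) (Zero L X (Dom L k)).
        k \<rhd> \<mu> = Id2 L (Zero L X (Cod L k)) \<longrightarrow> \<mu> = Id2 L (Zero L X (Dom L k))))"
  for L (structure)

definition zero_ideal_weakly_closed :: "('o, 'm, 'c, 'x) pointed_two_cat_scheme \<Rightarrow> bool" where
  "zero_ideal_weakly_closed L \<longleftrightarrow>
    zero_ideal_weakly_closed_kernels L \<and> zero_ideal_weakly_closed_kernels (op_cat L)"

lemma zero_ideal_weakly_closed_kernels_op_iff:
  "zero_ideal_weakly_closed_kernels (op_cat L) \<longleftrightarrow>
    (\<forall>f c \<beta>. is_2cokernel L f c \<beta> \<longrightarrow>
      (\<forall>Y \<in> Obj L. \<forall>s \<in> hom1 L (Cod L c) Y. \<forall>\<delta> \<in> hom2 L (s \<cdot> c) (Zero L (Dom L c) Y).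
        \<delta> \<lhd> f = s \<rhd> \<beta> \<longrightarrow> (\<exists>\<psi> \<in> hom2 L s (Zero L (Cod L c) Y). \<psi> \<lhd> c = \<delta>)) \<and>
      (\<forall>Y \<in> Obj L. \<forall>\<mu> \<in> hom2 L (Zero L (Cod L c) Y) (Zero L (Cod L c) Y).
        \<mu> \<lhd> c = Id2 L (Zero L (Dom L c) Y) \<longrightarrow> \<mu> = Id2 L (Zero L (Cod L c) Y)))"
  for L (structure)
  by (simp add: zero_ideal_weakly_closed_kernels_def is_2cokernel_def)

locale weakly_puppe_two_exact = gpd_star_category L
  for L :: "('o, 'm, 'c, 'x) pointed_two_cat_scheme" (structure) +
  assumes has_2kernels: "has_2kernels L"
    and has_2cokernels: "has_2cokernels L"
    and weakly_closed: "zero_ideal_weakly_closed L"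
    and two_kernel_normal: "is_2kernel L f k \<alpha> \<Longrightarrow> is_2kernel_of_its_2cokernel L k"
    and two_cokernel_normal: "is_2cokernel L f c \<beta> \<Longrightarrow> is_2cokernel_of_its_2kernel L c"
    and factorization: "f \<in> Mor L \<Longrightarrow>
          \<exists>e m \<iota>. e \<in> Mor L \<and> m \<in> Mor L \<and> Cod L e = Dom L m \<and> \<iota> \<in> hom2 L f (m \<cdot> e) \<and>
            (\<exists>g \<beta>. is_2cokernel L g e \<beta>) \<and> (\<exists>h \<alpha>. is_2kernel L h m \<alpha>)"

end

theory Submission
  imports Defs
begin

text \<open>
  2-kernels are 0-faithful, so only the factorization needs work.  Let \<open>\<pi>\<close> be the pip of \<open>f\<close> and
  \<open>e\<close> a coroot of \<open>\<pi>\<close>; then \<open>f \<cong> m e\<close> because \<open>f \<pi> = 1\<close>, and \<open>e\<close> is fully 0-cofaithful, hence a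
  2-cokernel.  To see that \<open>m\<close> is 0-faithful, hence a 2-kernel, let \<open>m \<mu> = 1\<close> and let \<open>q\<close> be a
  coroot of \<open>\<mu>\<close>, so that \<open>m \<cong> m' q\<close>.  The fully 0-cofaithful \<open>q e\<close> kills the same 2-cells on zero
  as \<open>f\<close>, so \<open>\<pi>\<close> is its pip too and \<open>q e\<close> is a coroot of \<open>\<pi>\<close>.  Hence \<open>e \<cong> r q e\<close> for some \<open>r\<close>,
  which gives \<open>1 \<cong> r q\<close> and \<open>\<mu> = r q \<mu> = 1\<close>.
\<close>

section \<open>Whiskering in a strict 2-category\<close>

context strict_two_category
begin

lemma hom1_Mor: "f \<in> hom1 L A B \<Longrightarrow> f \<in> Mor L"
  and hom1_Dom: "f \<in> hom1 L A B \<Longrightarrow> Dom L f = A"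
  and hom1_Cod: "f \<in> hom1 L A B \<Longrightarrow> Cod L f = B"
  by (auto simp: hom1_def)

lemma hom1_Dom_Obj: "f \<in> hom1 L A B \<Longrightarrow> A \<in> Obj L"
  and hom1_Cod_Obj: "f \<in> hom1 L A B \<Longrightarrow> B \<in> Obj L"
  using Dom_Obj Cod_Obj by (auto simp: hom1_def)

lemma Mor_hom1: "f \<in> Mor L \<Longrightarrow> f \<in> hom1 L (Dom L f) (Cod L f)"
  by (simp add: hom1_def)

lemma hom2_Trg_hom1: "\<lbrakk>f \<in> hom1 L A B; \<alpha> \<in> hom2 L f g\<rbrakk> \<Longrightarrow> g \<in> hom1 L A B"
  using Dom_Trg Cod_Trg Trg_Mor by (auto simp: hom1_def hom2_def)

lemma lwhisker_hom:
  "\<lbrakk>f \<in> hom1 L A B; g \<in> hom1 L B C; \<alpha> \<in> hom2 L f f'\<rbrakk> \<Longrightarrow> g \<rhd> \<alpha> \<in> hom2 L (g \<cdot> f) (g \<cdot> f')"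
  unfolding lwhisker_def using HComp_hom Id2_hom hom1_Mor by blast

lemma rwhisker_hom:
  "\<lbrakk>f \<in> hom1 L A B; g \<in> hom1 L B C; \<beta> \<in> hom2 L g g'\<rbrakk> \<Longrightarrow> \<beta> \<lhd> f \<in> hom2 L (g \<cdot> f) (g' \<cdot> f)"
  unfolding rwhisker_def using HComp_hom Id2_hom hom1_Mor by blast

lemma lwhisker_Id2:
  "\<lbrakk>f \<in> hom1 L A B; g \<in> hom1 L B C\<rbrakk> \<Longrightarrow> g \<rhd> Id2 L f = Id2 L (g \<cdot> f)"
  unfolding lwhisker_def by (rule HComp_Id2)

lemma rwhisker_Id2:
  "\<lbrakk>f \<in> hom1 L A B; g \<in> hom1 L B C\<rbrakk> \<Longrightarrow> Id2 L g \<lhd> f = Id2 L (g \<cdot> f)"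
  unfolding rwhisker_def by (rule HComp_Id2)

lemma Id1_lwhisker: "\<lbrakk>f \<in> hom1 L A B; \<alpha> \<in> hom2 L f f'\<rbrakk> \<Longrightarrow> Id1 L B \<rhd> \<alpha> = \<alpha>"
  unfolding lwhisker_def by (rule Id_HComp)

lemma lwhisker_lwhisker:
  assumes "f \<in> hom1 L A B" "g \<in> hom1 L B C" "h \<in> hom1 L C D" "\<alpha> \<in> hom2 L f f'"
  shows "h \<rhd> (g \<rhd> \<alpha>) = (h \<cdot> g) \<rhd> \<alpha>"
  unfolding lwhisker_def
  using HComp_assoc[OF assms(1-4) Id2_hom Id2_hom] assms HComp_Id2 by (metis hom1_Mor)

lemma rwhisker_rwhisker:
  assumes "f \<in> hom1 L A B" "g \<in> hom1 L B C" "h \<in> hom1 L C D" "\<gamma> \<in> hom2 L h h'"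
  shows "(\<gamma> \<lhd> g) \<lhd> f = \<gamma> \<lhd> (g \<cdot> f)"
  unfolding rwhisker_def
  using HComp_assoc[OF assms(1-3) Id2_hom Id2_hom assms(4)] assms HComp_Id2 by (metis hom1_Mor)

lemma lwhisker_rwhisker:
  assumes "f \<in> hom1 L A B" "g \<in> hom1 L B C" "h \<in> hom1 L C D" "\<beta> \<in> hom2 L g g'"
  shows "(h \<rhd> \<beta>) \<lhd> f = h \<rhd> (\<beta> \<lhd> f)"
  unfolding lwhisker_def rwhisker_def
  using HComp_assoc[OF assms(1-3) Id2_hom assms(4) Id2_hom] assms by (metis hom1_Mor)

text \<open>Both sides equal the horizontal composite \<open>\<beta> \<star> \<alpha>\<close>: apply
  \<open>interchange\<close> with identities inserted in the two possible orders.\<close>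

lemma whisker_exchange:
  assumes f: "f \<in> hom1 L A B" and g: "g \<in> hom1 L B C"
    and \<alpha>: "\<alpha> \<in> hom2 L f f'" and \<beta>: "\<beta> \<in> hom2 L g g'"
  shows "(\<beta> \<lhd> f') \<bullet> (g \<rhd> \<alpha>) = (g' \<rhd> \<alpha>) \<bullet> (\<beta> \<lhd> f)"
proof -
  have f': "f' \<in> hom1 L A B" and g': "g' \<in> hom1 L B C"
    using assms hom2_Trg_hom1 by blast+
  note ids = Id2_hom[OF hom1_Mor]
  have "(\<beta> \<lhd> f') \<bullet> (g \<rhd> \<alpha>) = \<beta> \<star> \<alpha>"
    using interchange[OF f g \<alpha> ids[OF f'] ids[OF g] \<beta>] \<alpha> \<beta>
    by (simp add: lwhisker_def rwhisker_def Id2_VComp VComp_Id2)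
  moreover have "(g' \<rhd> \<alpha>) \<bullet> (\<beta> \<lhd> f) = \<beta> \<star> \<alpha>"
    using interchange[OF f g ids[OF f] \<alpha> \<beta> ids[OF g']] \<alpha> \<beta>
    by (simp add: lwhisker_def rwhisker_def Id2_VComp VComp_Id2)
  ultimately show ?thesis by simp
qed

end

section \<open>Duality and the action of isomorphic morphisms\<close>

context gpd_star_category
begin

text \<open>Under reversal of morphisms each axiom is either preserved or exchanged with a partner.
  Facts about 2-cokernels, coroots and cofaithfulness are then read off from their duals in
  \<open>op_cat L\<close>.\<close>

lemma op_gpd_star_category: "gpd_star_category (op_cat L)"
proof (unfold_locales, goal_cases)
  case 1 then show ?case by (simp add: Cod_Obj)
next
  case 2 then show ?case by (simp add: Dom_Obj)
next
  case 3 then show ?case by (simp add: Id1_hom)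
next
  case 4 then show ?case by (auto intro: Comp_hom)
next
  case 5 then show ?case by (auto intro: Comp_assoc[symmetric])
next
  case 6 then show ?case by (auto intro: Id1_Comp)
next
  case 7 then show ?case by (auto intro: Comp_Id1)
next
  case 8 then show ?case by (simp add: Src_Mor)
next
  case 9 then show ?case by (simp add: Trg_Mor)
next
  case 10 then show ?case by (simp add: Cod_Trg)
next
  case 11 then show ?case by (simp add: Dom_Trg)
next
  case 12 then show ?case by (simp add: Id2_hom)
next
  case 13 then show ?case by (auto intro: VComp_hom)
next
  case 14 then show ?case by (auto intro: VComp_assoc)
next
  case 15 then show ?case by (auto intro: VComp_Id2)
next
  case 16 then show ?case by (auto intro: Id2_VComp)
next
  case 17 then show ?case by (auto intro: HComp_hom)
next
  case 18 then show ?case by (auto intro: HComp_assoc[symmetric])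
next
  case 19 then show ?case by (auto intro: Id_HComp)
next
  case 20 then show ?case by (auto intro: HComp_Id)
next
  case 21 then show ?case by (auto intro: HComp_Id2)
next
  case 22 then show ?case by (auto intro: interchange)
next
  case 23 then show ?case using Cell_invertible by auto
next
  case 24 then show ?case by (simp add: Zero_hom)
next
  case 25 then show ?case by (auto intro: Zero_Comp)
next
  case 26 then show ?case by (auto intro: Comp_Zero)
next
  case 27 then show ?case by (auto intro: Zero_whisker)
next
  case 28 then show ?case by (auto intro: whisker_Zero)
qed

text \<open>Isomorphic morphisms act in the same way on 2-cells between zero morphisms.\<close>

lemma lwhisker_cong:
  assumes X: "X \<in> Obj L" and f: "f \<in> hom1 L A B" and \<phi>: "\<phi> \<in> hom2 L f g"
    and \<alpha>: "\<alpha> \<in> hom2 L (Zero L X A) (Zero L X A)"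
  shows "f \<rhd> \<alpha> = g \<rhd> \<alpha>"
proof -
  note Z = Zero_hom[OF X hom1_Dom_Obj[OF f]]
  have g: "g \<in> hom1 L A B" using f \<phi> hom2_Trg_hom1 by blast
  have 1: "f \<rhd> \<alpha> \<in> hom2 L (Zero L X B) (Zero L X B)" "g \<rhd> \<alpha> \<in> hom2 L (Zero L X B) (Zero L X B)"
    using lwhisker_hom[OF Z f \<alpha>] lwhisker_hom[OF Z g \<alpha>] f g X by (auto simp: Comp_Zero)
  \<comment> \<open>Both whiskerings of \<phi> with a zero morphism in the exchange law are
    identities, so only the two whiskerings of \<alpha> remain.\<close>
  show ?thesis
    using whisker_exchange[OF Z f \<alpha> \<phi>] 1
    by (simp add: whisker_Zero[OF X f \<phi>] Id2_VComp[OF 1(1)] VComp_Id2[OF 1(2)])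
qed

lemma rwhisker_cong:
  assumes Y: "Y \<in> Obj L" and f: "f \<in> hom1 L A B" and \<phi>: "\<phi> \<in> hom2 L f g"
    and \<alpha>: "\<alpha> \<in> hom2 L (Zero L B Y) (Zero L B Y)"
  shows "\<alpha> \<lhd> f = \<alpha> \<lhd> g"
  using gpd_star_category.lwhisker_cong[OF op_gpd_star_category, of Y f B A \<phi> g \<alpha>] assms by simp

section \<open>2-kernels and weak closedness of the zero ideal\<close>

lemma is_2kernel_zero_cells:
  assumes k: "is_2kernel L f k \<alpha>" and X: "X \<in> Obj L"
    and s: "s \<in> hom1 L X (Dom L k)" and \<delta>: "\<delta> \<in> hom2 L (k \<cdot> s) (Zero L X (Cod L k))"
    and eq: "f \<rhd> \<delta> = \<alpha> \<lhd> s"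
  shows "\<exists>!\<psi>. \<psi> \<in> hom2 L s (Zero L X (Dom L k)) \<and> k \<rhd> \<psi> = \<delta>"
proof -
  have f1: "f \<in> hom1 L (Dom L f) (Cod L f)" and k1: "k \<in> hom1 L (Dom L k) (Dom L f)"
    and cod: "Cod L k = Dom L f"
    and \<alpha>: "\<alpha> \<in> hom2 L (f \<cdot> k) (Zero L (Dom L k) (Cod L f))"
    and fill: "\<And>Z u v \<kappa>. \<lbrakk>Z \<in> Obj L; u \<in> hom1 L Z (Dom L k); v \<in> hom1 L Z (Dom L k);
        \<kappa> \<in> hom2 L (k \<cdot> u) (k \<cdot> v); (\<alpha> \<lhd> v) \<bullet> (f \<rhd> \<kappa>) = \<alpha> \<lhd> u\<rbrakk>
        \<Longrightarrow> \<exists>!\<mu>. \<mu> \<in> hom2 L u v \<and> k \<rhd> \<mu> = \<kappa>"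
    using k unfolding is_2kernel_def by (auto simp: hom1_def)
  note fk = Comp_hom[OF k1 f1]
  have "f \<rhd> \<delta> \<in> hom2 L (f \<cdot> (k \<cdot> s)) (Zero L X (Cod L f))"
    using lwhisker_hom[OF Comp_hom[OF s k1] f1 \<delta>] by (simp add: cod Comp_Zero[OF X f1])
  \<comment> \<open>Take the second morphism in \<open>fill\<close> to be zero: \<alpha> whiskered
    with it is an identity, so the compatibility condition reduces to \<open>eq\<close>.\<close>
  then have "(\<alpha> \<lhd> Zero L X (Dom L k)) \<bullet> (f \<rhd> \<delta>) = \<alpha> \<lhd> s"
    by (simp add: whisker_Zero[OF X fk \<alpha>] Id2_VComp eq[symmetric])
  then show ?thesis
    using fill[OF X s Zero_hom[OF X hom1_Dom_Obj[OF k1]], of \<delta>] \<delta>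
    by (simp add: Comp_Zero[OF X k1] cod)
qed

text \<open>Apply the preceding lemma with s = 0 and \<delta> = 1: both \<mu> and the identity lift
  \<delta>, so uniqueness identifies them.\<close>

lemma is_2kernel_zero_faithful:
  assumes k: "is_2kernel L f k \<alpha>" shows "zero_faithful L k"
  unfolding zero_faithful_def
proof (intro ballI impI)
  fix X \<mu>
  assume X: "X \<in> Obj L" and \<mu>: "\<mu> \<in> hom2 L (Zero L X (Dom L k)) (Zero L X (Dom L k))"
    and eq: "k \<rhd> \<mu> = Id2 L (Zero L X (Cod L k))"
  have f1: "f \<in> hom1 L (Dom L f) (Cod L f)" and k1: "k \<in> hom1 L (Dom L k) (Cod L k)"
    and cod: "Cod L k = Dom L f"
    and \<alpha>: "\<alpha> \<in> hom2 L (f \<cdot> k) (Zero L (Dom L k) (Cod L f))"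
    using k unfolding is_2kernel_def by (auto simp: hom1_def)
  note Z = Zero_hom[OF X hom1_Dom_Obj[OF k1]] and Z' = Zero_hom[OF X hom1_Cod_Obj[OF k1]]
  have fk: "f \<cdot> k \<in> hom1 L (Dom L k) (Cod L f)" using k1 f1 cod by (auto intro: Comp_hom)
  have "f \<rhd> Id2 L (Zero L X (Cod L k)) = \<alpha> \<lhd> Zero L X (Dom L k)"
    using lwhisker_Id2[OF Z'[unfolded cod] f1]
    by (simp add: whisker_Zero[OF X fk \<alpha>] Comp_Zero[OF X f1] cod)
  then have "\<exists>!\<psi>. \<psi> \<in> hom2 L (Zero L X (Dom L k)) (Zero L X (Dom L k)) \<and>
      k \<rhd> \<psi> = Id2 L (Zero L X (Cod L k))"
    using is_2kernel_zero_cells[OF k X Z] Id2_hom[OF hom1_Mor[OF Z']] by (simp add: Comp_Zero[OF X k1])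
  moreover have "k \<rhd> Id2 L (Zero L X (Dom L k)) = Id2 L (Zero L X (Cod L k))"
    using lwhisker_Id2[OF Z k1] by (simp add: Comp_Zero[OF X k1])
  ultimately show "\<mu> = Id2 L (Zero L X (Dom L k))"
    using \<mu> eq Id2_hom[OF hom1_Mor[OF Z]] by blast
qed

lemma zero_ideal_weakly_closed_kernels: "zero_ideal_weakly_closed_kernels L"
  unfolding zero_ideal_weakly_closed_kernels_def
proof (intro allI impI conjI)
  fix f k \<alpha> assume k: "is_2kernel L f k \<alpha>"
  show "\<forall>X \<in> Obj L. \<forall>s \<in> hom1 L X (Dom L k). \<forall>\<delta> \<in> hom2 L (k \<cdot> s) (Zero L X (Cod L k)).
      f \<rhd> \<delta> = \<alpha> \<lhd> s \<longrightarrow> (\<exists>\<psi> \<in> hom2 L s (Zero L X (Dom L k)). k \<rhd> \<psi> = \<delta>)"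
    using is_2kernel_zero_cells[OF k] by blast
  show "\<forall>X \<in> Obj L. \<forall>\<mu> \<in> hom2 L (Zero L X (Dom L k)) (Zero L X (Dom L k)).
      k \<rhd> \<mu> = Id2 L (Zero L X (Cod L k)) \<longrightarrow> \<mu> = Id2 L (Zero L X (Dom L k))"
    using is_2kernel_zero_faithful[OF k] by (simp add: zero_faithful_def)
qed

lemma zero_ideal_weakly_closed: "zero_ideal_weakly_closed L"
  unfolding zero_ideal_weakly_closed_def
  using zero_ideal_weakly_closed_kernels
    gpd_star_category.zero_ideal_weakly_closed_kernels[OF op_gpd_star_category] by blast

section \<open>Loop objects, and the construction of pips and roots from them\<close>

lemma zero_object_unique_cell:
  assumes Z: "zero_object L Z" and x: "x \<in> hom1 L X Z" and y: "y \<in> hom1 L X Z"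
  shows "\<exists>!\<kappa>. \<kappa> \<in> hom2 L x y"
proof -
  obtain c \<eta> where \<eta>: "\<And>x. x \<in> hom1 L X Z \<Longrightarrow> \<eta> x \<in> hom2 L x c"
    and nat: "\<And>x y \<kappa>. \<lbrakk>x \<in> hom1 L X Z; y \<in> hom1 L X Z; \<kappa> \<in> hom2 L x y\<rbrakk> \<Longrightarrow> \<eta> y \<bullet> \<kappa> = \<eta> x"
    using Z hom1_Dom_Obj[OF x] unfolding zero_object_def hom_equiv_terminal_def by metis
  obtain \<theta> where \<theta>: "\<theta> \<in> hom2 L c y" "\<theta> \<bullet> \<eta> y = Id2 L y"
    using Cell_invertible[OF \<eta>[OF y]] by blast
  \<comment> \<open>Naturality gives \<eta> y \<bullet> \<kappa> = \<eta> x; cancelling the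
    invertible \<eta> y determines \<kappa>.\<close>
  have "\<kappa> = \<theta> \<bullet> \<eta> x" if \<kappa>: "\<kappa> \<in> hom2 L x y" for \<kappa>
    using VComp_assoc[OF \<kappa> \<eta>[OF y] \<theta>(1)] nat[OF x y \<kappa>] Id2_VComp[OF \<kappa>] \<theta>(2) by simp
  then show ?thesis using VComp_hom[OF \<eta>[OF x] \<theta>(1)] by blast
qed

text \<open>The loop object of \<open>B\<close>, the 2-kernel of \<open>0 \<rightarrow> B\<close>, classifies the 2-cells on zero into \<open>B\<close>.\<close>

lemma loop_object:
  assumes Z: "zero_object L Z" and ker: "has_2kernels L" and B: "B \<in> Obj L"
  obtains S \<sigma> where "S \<in> Obj L" and "\<sigma> \<in> hom2 L (Zero L S B) (Zero L S B)"
    and "\<And>X \<mu>. \<lbrakk>X \<in> Obj L; \<mu> \<in> hom2 L (Zero L X B) (Zero L X B)\<rbrakk> \<Longrightarrow> \<exists>u \<in> hom1 L X S. \<mu> = \<sigma> \<lhd> u"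
    and "\<And>X u v. \<lbrakk>u \<in> hom1 L X S; v \<in> hom1 L X S; \<sigma> \<lhd> u = \<sigma> \<lhd> v\<rbrakk> \<Longrightarrow> \<exists>!\<chi>. \<chi> \<in> hom2 L u v"
proof -
  let ?z = "Zero L Z B"
  have ZO: "Z \<in> Obj L" using Z by (simp add: zero_object_def)
  have z: "?z \<in> hom1 L Z B" using ZO B by (rule Zero_hom)
  note [simp] = hom1_Dom[OF z] hom1_Cod[OF z]
  obtain s \<sigma> where k: "is_2kernel L ?z s \<sigma>"
    using ker hom1_Mor[OF z] by (auto simp: has_2kernels_def)
  define S where "S = Dom L s"
  have s: "s \<in> hom1 L S Z" and \<sigma>: "\<sigma> \<in> hom2 L (?z \<cdot> s) (Zero L S B)"
    and lift: "\<And>X x \<mu>. \<lbrakk>X \<in> Obj L; x \<in> hom1 L X Z; \<mu> \<in> hom2 L (?z \<cdot> x) (Zero L X B)\<rbrakk>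
        \<Longrightarrow> \<exists>u \<in> hom1 L X S. \<exists>\<gamma> \<in> hom2 L x (s \<cdot> u). \<mu> = (\<sigma> \<lhd> u) \<bullet> (?z \<rhd> \<gamma>)"
    and fill: "\<And>X u v \<kappa>. \<lbrakk>X \<in> Obj L; u \<in> hom1 L X S; v \<in> hom1 L X S;
        \<kappa> \<in> hom2 L (s \<cdot> u) (s \<cdot> v); (\<sigma> \<lhd> v) \<bullet> (?z \<rhd> \<kappa>) = \<sigma> \<lhd> u\<rbrakk>
        \<Longrightarrow> \<exists>!\<mu>. \<mu> \<in> hom2 L u v \<and> s \<rhd> \<mu> = \<kappa>"
    using k unfolding is_2kernel_def S_def by (simp_all add: hom1_def)
  have SO: "S \<in> Obj L" using s by (rule hom1_Dom_Obj)
  have \<sigma>0: "\<sigma> \<in> hom2 L (Zero L S B) (Zero L S B)" using \<sigma> Zero_Comp[OF B s] by simp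
  have \<sigma>u: "\<sigma> \<lhd> u \<in> hom2 L (Zero L X B) (Zero L X B)" if "u \<in> hom1 L X S" for X u
    using rwhisker_hom[OF that Zero_hom[OF SO B] \<sigma>0] Zero_Comp[OF B that] by simp
  show thesis
  proof
    show "S \<in> Obj L" "\<sigma> \<in> hom2 L (Zero L S B) (Zero L S B)" by (fact SO \<sigma>0)+
  next
    fix X \<mu> assume X: "X \<in> Obj L" and \<mu>: "\<mu> \<in> hom2 L (Zero L X B) (Zero L X B)"
    \<comment> \<open>Test the 2-kernel on the zero morphism into Z; the correction term
      \<open>?z \<rhd> \<gamma>\<close> is then an identity.\<close>
    note x = Zero_hom[OF X ZO]
    obtain u \<gamma> where u: "u \<in> hom1 L X S" and \<gamma>: "\<gamma> \<in> hom2 L (Zero L X Z) (s \<cdot> u)"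
      and eq: "\<mu> = (\<sigma> \<lhd> u) \<bullet> (?z \<rhd> \<gamma>)"
      using lift[OF X x, of \<mu>] \<mu> Zero_Comp[OF B x] by auto
    then show "\<exists>u \<in> hom1 L X S. \<mu> = \<sigma> \<lhd> u"
      using Zero_whisker[OF B x \<gamma>] VComp_Id2[OF \<sigma>u[OF u]] by auto
  next
    fix X u v assume u: "u \<in> hom1 L X S" and v: "v \<in> hom1 L X S" and eq: "\<sigma> \<lhd> u = \<sigma> \<lhd> v"
    note su = Comp_hom[OF u s] and sv = Comp_hom[OF v s]
    obtain \<kappa> where \<kappa>: "\<kappa> \<in> hom2 L (s \<cdot> u) (s \<cdot> v)"
      and uniq: "\<And>\<kappa>'. \<kappa>' \<in> hom2 L (s \<cdot> u) (s \<cdot> v) \<Longrightarrow> \<kappa>' = \<kappa>"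
      using zero_object_unique_cell[OF Z su sv] by blast
    \<comment> \<open>Whiskering with the zero morphism \<open>?z\<close> trivializes \<kappa>, so
      compatibility is just the assumed equality.\<close>
    have "(\<sigma> \<lhd> v) \<bullet> (?z \<rhd> \<kappa>) = \<sigma> \<lhd> u"
      using Zero_whisker[OF B su \<kappa>] VComp_Id2[OF \<sigma>u[OF v]] eq by simp
    then have "\<exists>!\<mu>. \<mu> \<in> hom2 L u v \<and> s \<rhd> \<mu> = \<kappa>"
      using fill[OF hom1_Dom_Obj[OF u] u v \<kappa>] by simp
    \<comment> \<open>For every \<chi> from u to v, \<open>s \<rhd> \<chi>\<close> must be the only
      cell \<kappa>, so uniqueness of fillers over \<kappa> is uniqueness among all cells.\<close>
    then show "\<exists>!\<chi>. \<chi> \<in> hom2 L u v"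
      using uniq lwhisker_hom[OF u s] by metis
  qed
qed

text \<open>Whiskering with the 2-kernel k : K \<rightarrow> A identifies the 2-cells on zero into K
  with those into A that f kills. Hence the loop object P of K carries the pip, with universal cell
  \<open>k \<rhd> \<omega>\<close>.\<close>

lemma pip_exists:
  assumes Z: "zero_object L Z" and ker: "has_2kernels L" and f: "f \<in> hom1 L A B"
  shows "\<exists>P \<pi>. is_pip L f P \<pi>"
proof -
  note [simp] = hom1_Dom[OF f] hom1_Cod[OF f]
  have A: "A \<in> Obj L" and B: "B \<in> Obj L" using f hom1_Dom_Obj hom1_Cod_Obj by blast+
  obtain k \<alpha> where k: "is_2kernel L f k \<alpha>"
    using ker hom1_Mor[OF f] by (auto simp: has_2kernels_def)
  define K where "K = Dom L k"
  have k1: "k \<in> hom1 L K A" and \<alpha>: "\<alpha> \<in> hom2 L (f \<cdot> k) (Zero L K B)"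
    and fill: "\<And>X u v \<kappa>. \<lbrakk>X \<in> Obj L; u \<in> hom1 L X K; v \<in> hom1 L X K;
        \<kappa> \<in> hom2 L (k \<cdot> u) (k \<cdot> v); (\<alpha> \<lhd> v) \<bullet> (f \<rhd> \<kappa>) = \<alpha> \<lhd> u\<rbrakk>
        \<Longrightarrow> \<exists>!\<mu>. \<mu> \<in> hom2 L u v \<and> k \<rhd> \<mu> = \<kappa>"
    using k unfolding is_2kernel_def K_def by (simp_all add: hom1_def)
  have KO: "K \<in> Obj L" using k1 by (rule hom1_Dom_Obj)
  note fk = Comp_hom[OF k1 f]
  have fill0: "\<exists>!\<mu>. \<mu> \<in> hom2 L (Zero L X K) (Zero L X K) \<and> k \<rhd> \<mu> = \<chi>"
    if X: "X \<in> Obj L" and \<chi>: "\<chi> \<in> hom2 L (Zero L X A) (Zero L X A)"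
      and eq: "f \<rhd> \<chi> = Id2 L (Zero L X B)" for X \<chi>
  proof -
    have "Id2 L (Zero L X B) \<bullet> Id2 L (Zero L X B) = Id2 L (Zero L X B)"
      using VComp_Id2 Id2_hom hom1_Mor Zero_hom[OF X B] by blast
    then show ?thesis
      using fill[OF X Zero_hom[OF X KO] Zero_hom[OF X KO], of \<chi>] \<chi> eq
      by (simp add: Comp_Zero[OF X k1] whisker_Zero[OF X fk \<alpha>])
  qed
  \<comment> \<open>By \<alpha>, \<open>f \<cdot> k\<close> is isomorphic to a zero morphism and
    therefore acts on \<mu> as zero does.\<close>
  have fk0: "f \<rhd> (k \<rhd> \<mu>) = Id2 L (Zero L X B)"
    if X: "X \<in> Obj L" and \<mu>: "\<mu> \<in> hom2 L (Zero L X K) (Zero L X K)" for X \<mu>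
    using lwhisker_lwhisker[OF Zero_hom[OF X KO] k1 f \<mu>] lwhisker_cong[OF X fk \<alpha> \<mu>]
      Zero_whisker[OF B Zero_hom[OF X KO] \<mu>] by simp
  have k\<mu>: "k \<rhd> \<mu> \<in> hom2 L (Zero L X A) (Zero L X A)"
    if X: "X \<in> Obj L" and \<mu>: "\<mu> \<in> hom2 L (Zero L X K) (Zero L X K)" for X \<mu>
    using lwhisker_hom[OF Zero_hom[OF X KO] k1 \<mu>] by (simp add: Comp_Zero[OF X k1])
  from Z ker KO obtain P \<omega> where P: "P \<in> Obj L"
    and \<omega>: "\<omega> \<in> hom2 L (Zero L P K) (Zero L P K)"
    and ex: "\<And>X \<mu>. \<lbrakk>X \<in> Obj L; \<mu> \<in> hom2 L (Zero L X K) (Zero L X K)\<rbrakk>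
        \<Longrightarrow> \<exists>u \<in> hom1 L X P. \<mu> = \<omega> \<lhd> u"
    and un: "\<And>X u v. \<lbrakk>u \<in> hom1 L X P; v \<in> hom1 L X P; \<omega> \<lhd> u = \<omega> \<lhd> v\<rbrakk>
        \<Longrightarrow> \<exists>!\<chi>. \<chi> \<in> hom2 L u v"
    by (rule loop_object) (rule that; assumption)
  have assoc: "(k \<rhd> \<omega>) \<lhd> x = k \<rhd> (\<omega> \<lhd> x)"
    and \<omega>x: "\<omega> \<lhd> x \<in> hom2 L (Zero L X K) (Zero L X K)" if "x \<in> hom1 L X P" for X x
    using lwhisker_rwhisker[OF that Zero_hom[OF P KO] k1 \<omega>]
      rwhisker_hom[OF that Zero_hom[OF P KO] \<omega>] Zero_Comp[OF KO that] by simp_all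
  have "is_pip L f P (k \<rhd> \<omega>)"
    unfolding is_pip_def
  proof (intro conjI ballI impI)
    show "f \<in> Mor L" "P \<in> Obj L" using f P hom1_Mor by auto
    show "k \<rhd> \<omega> \<in> hom2 L (Zero L P (Dom L f)) (Zero L P (Dom L f))"
      using k\<mu>[OF P \<omega>] by simp
    show "f \<rhd> (k \<rhd> \<omega>) = Id2 L (Zero L P (Cod L f))" using fk0[OF P \<omega>] by simp
  next
    fix X \<chi> assume X: "X \<in> Obj L" and \<chi>: "\<chi> \<in> hom2 L (Zero L X (Dom L f)) (Zero L X (Dom L f))"
      and eq: "f \<rhd> \<chi> = Id2 L (Zero L X (Cod L f))"
    then obtain \<mu> where \<mu>: "\<mu> \<in> hom2 L (Zero L X K) (Zero L X K)" and k\<mu>: "k \<rhd> \<mu> = \<chi>"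
      using fill0[OF X, of \<chi>] by auto
    from ex[OF X \<mu>] obtain x where "x \<in> hom1 L X P" "\<mu> = \<omega> \<lhd> x" by blast
    then show "\<exists>x \<in> hom1 L X P. \<chi> = (k \<rhd> \<omega>) \<lhd> x" using assoc k\<mu> by auto
  next
    fix X x y assume X: "X \<in> Obj L" and x: "x \<in> hom1 L X P" and y: "y \<in> hom1 L X P"
      and eq: "(k \<rhd> \<omega>) \<lhd> x = (k \<rhd> \<omega>) \<lhd> y"
    \<comment> \<open>Both are lifts through k of the same cell killed by f; \<open>fill0\<close>
      makes the lift unique.\<close>
    then have "\<omega> \<lhd> x = \<omega> \<lhd> y"
      using fill0[OF X k\<mu>[OF X \<omega>x[OF x]] fk0[OF X \<omega>x[OF x]]] \<omega>x[OF x] \<omega>x[OF y] assoc by metis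
    then show "\<exists>!\<chi>. \<chi> \<in> hom2 L x y" using un x y by blast
  qed
  then show ?thesis by blast
qed

text \<open>The loop object S of B represents \<pi> by some u : A \<rightarrow> S. Since \<pi> x = 1
  exactly when u x is isomorphic to zero, a 2-kernel of u is a root.\<close>

lemma root_exists:
  assumes Z: "zero_object L Z" and ker: "has_2kernels L"
    and A: "A \<in> Obj L" and B: "B \<in> Obj L" and \<pi>: "\<pi> \<in> hom2 L (Zero L A B) (Zero L A B)"
  shows "\<exists>r. is_root L A B \<pi> r"
proof -
  from Z ker B obtain S \<sigma> where S: "S \<in> Obj L"
    and \<sigma>: "\<sigma> \<in> hom2 L (Zero L S B) (Zero L S B)"
    and ex: "\<And>X \<mu>. \<lbrakk>X \<in> Obj L; \<mu> \<in> hom2 L (Zero L X B) (Zero L X B)\<rbrakk>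
        \<Longrightarrow> \<exists>u \<in> hom1 L X S. \<mu> = \<sigma> \<lhd> u"
    and un: "\<And>X u v. \<lbrakk>u \<in> hom1 L X S; v \<in> hom1 L X S; \<sigma> \<lhd> u = \<sigma> \<lhd> v\<rbrakk>
        \<Longrightarrow> \<exists>!\<chi>. \<chi> \<in> hom2 L u v"
    by (rule loop_object) (rule that; assumption)
  from ex[OF A \<pi>] obtain u where u: "u \<in> hom1 L A S" and \<pi>u: "\<pi> = \<sigma> \<lhd> u" by blast
  note [simp] = hom1_Dom[OF u] hom1_Cod[OF u]
  note \<sigma>S = Zero_hom[OF S B]
  obtain r \<epsilon> where k: "is_2kernel L u r \<epsilon>"
    using ker hom1_Mor[OF u] by (auto simp: has_2kernels_def)
  define R where "R = Dom L r"
  have r: "r \<in> hom1 L R A" and \<epsilon>: "\<epsilon> \<in> hom2 L (u \<cdot> r) (Zero L R S)"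
    and lift: "\<And>X x \<mu>. \<lbrakk>X \<in> Obj L; x \<in> hom1 L X A; \<mu> \<in> hom2 L (u \<cdot> x) (Zero L X S)\<rbrakk>
        \<Longrightarrow> \<exists>x' \<in> hom1 L X R. \<exists>\<gamma> \<in> hom2 L x (r \<cdot> x'). \<mu> = (\<epsilon> \<lhd> x') \<bullet> (u \<rhd> \<gamma>)"
    and fill: "\<And>X x y \<kappa>. \<lbrakk>X \<in> Obj L; x \<in> hom1 L X R; y \<in> hom1 L X R;
        \<kappa> \<in> hom2 L (r \<cdot> x) (r \<cdot> y); (\<epsilon> \<lhd> y) \<bullet> (u \<rhd> \<kappa>) = \<epsilon> \<lhd> x\<rbrakk>
        \<Longrightarrow> \<exists>!\<mu>. \<mu> \<in> hom2 L x y \<and> r \<rhd> \<mu> = \<kappa>"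
    using k unfolding is_2kernel_def R_def by (simp_all add: hom1_def)
  have R: "R \<in> Obj L" using r by (rule hom1_Dom_Obj)
  have \<pi>x: "\<pi> \<lhd> x = \<sigma> \<lhd> (u \<cdot> x)" if "x \<in> hom1 L X A" for X x
    using rwhisker_rwhisker[OF that u \<sigma>S \<sigma>] \<pi>u by simp
  have \<sigma>0: "\<sigma> \<lhd> Zero L X S = Id2 L (Zero L X B)" if "X \<in> Obj L" for X
    by (rule whisker_Zero[OF that \<sigma>S \<sigma>])
  have "is_root L A B \<pi> r"
    unfolding is_root_def
  proof (intro conjI ballI impI)
    show "A \<in> Obj L" "B \<in> Obj L" "\<pi> \<in> hom2 L (Zero L A B) (Zero L A B)" by fact+
    show "r \<in> Mor L" "Cod L r = A" using r hom1_Mor hom1_Cod by blast+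
    have "\<pi> \<lhd> r = \<sigma> \<lhd> Zero L R S"
      using \<pi>x[OF r] rwhisker_cong[OF B Comp_hom[OF r u] \<epsilon> \<sigma>] by simp
    then show "\<pi> \<lhd> r = Id2 L (Zero L (Dom L r) B)" using \<sigma>0[OF R] by (simp add: R_def)
  next
    fix X x assume X: "X \<in> Obj L" and x: "x \<in> hom1 L X A" and "\<pi> \<lhd> x = Id2 L (Zero L X B)"
    then have "\<sigma> \<lhd> (u \<cdot> x) = \<sigma> \<lhd> Zero L X S" using \<pi>x[OF x] \<sigma>0[OF X] by simp
    then obtain \<mu> where "\<mu> \<in> hom2 L (u \<cdot> x) (Zero L X S)"
      using un[OF Comp_hom[OF x u] Zero_hom[OF X S]] by blast
    then show "\<exists>x' \<in> hom1 L X (Dom L r). \<exists>\<xi>. \<xi> \<in> hom2 L x (r \<cdot> x')"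
      using lift[OF X x] unfolding R_def by blast
  next
    fix X x y \<kappa>
    assume X: "X \<in> Obj L" and "x \<in> hom1 L X (Dom L r)" "y \<in> hom1 L X (Dom L r)"
      and \<kappa>: "\<kappa> \<in> hom2 L (r \<cdot> x) (r \<cdot> y)"
    then have x: "x \<in> hom1 L X R" and y: "y \<in> hom1 L X R" by (simp_all add: R_def)
    note ur = Comp_hom[OF r u]
    have \<epsilon>x: "\<epsilon> \<lhd> x \<in> hom2 L (u \<cdot> (r \<cdot> x)) (Zero L X S)" if "x \<in> hom1 L X R" for x
      using rwhisker_hom[OF that ur \<epsilon>] by (simp add: Zero_Comp[OF S that] Comp_assoc[OF that r u])
    have "u \<rhd> \<kappa> \<in> hom2 L (u \<cdot> (r \<cdot> x)) (u \<cdot> (r \<cdot> y))"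
      using lwhisker_hom[OF Comp_hom[OF x r] u \<kappa>] .
    then have 1: "(\<epsilon> \<lhd> y) \<bullet> (u \<rhd> \<kappa>) \<in> hom2 L (u \<cdot> (r \<cdot> x)) (Zero L X S)"
      using \<epsilon>x[OF y] by (rule VComp_hom)
    have urx: "u \<cdot> (r \<cdot> x) \<in> hom1 L X S" using Comp_hom[OF Comp_hom[OF x r] u] .
    \<comment> \<open>A root must lift every \<kappa>, whereas a 2-kernel lifts only compatible
      ones. Compatibility is automatic here, since \<open>un\<close> allows just one cell from
      \<open>u \<cdot> (r \<cdot> x)\<close> to zero.\<close>
    have "(\<epsilon> \<lhd> y) \<bullet> (u \<rhd> \<kappa>) = \<epsilon> \<lhd> x"
      using un[OF urx Zero_hom[OF X S] rwhisker_cong[OF B urx \<epsilon>x[OF x] \<sigma>]] 1 \<epsilon>x[OF x] by blast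
    then show "\<exists>!\<mu>. \<mu> \<in> hom2 L x y \<and> r \<rhd> \<mu> = \<kappa>" using fill[OF X x y \<kappa>] by blast
  qed
  then show ?thesis by blast
qed

lemma coroot_exists:
  assumes "zero_object L Z" "has_2cokernels L" "A \<in> Obj L" "B \<in> Obj L"
    and "\<pi> \<in> hom2 L (Zero L A B) (Zero L A B)"
  shows "\<exists>r. is_coroot L A B \<pi> r"
proof -
  have "zero_object (op_cat L) Z"
    using assms(1) by (simp add: zero_object_def hom_equiv_terminal_def)
  moreover have "has_2kernels (op_cat L)"
    using assms(2) by (simp add: has_2kernels_def has_2cokernels_def is_2cokernel_def)
  ultimately show ?thesis
    using gpd_star_category.root_exists[OF op_gpd_star_category, of Z B A \<pi>] assms(3-)
    by (simp add: is_coroot_def)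
qed

section \<open>Coroots and fully 0-cofaithful morphisms\<close>

lemma is_corootD:
  assumes "is_coroot L A B \<pi> r"
  shows "\<pi> \<in> hom2 L (Zero L A B) (Zero L A B)"
    and "r \<in> hom1 L B (Cod L r)"
    and "r \<rhd> \<pi> = Id2 L (Zero L A (Cod L r))"
    and "\<lbrakk>y \<in> hom1 L B Y; y \<rhd> \<pi> = Id2 L (Zero L A Y)\<rbrakk>
      \<Longrightarrow> \<exists>y' \<in> hom1 L (Cod L r) Y. \<exists>\<xi>. \<xi> \<in> hom2 L y (y' \<cdot> r)"
    and "\<lbrakk>x \<in> hom1 L (Cod L r) Y; y \<in> hom1 L (Cod L r) Y; \<kappa> \<in> hom2 L (x \<cdot> r) (y \<cdot> r)\<rbrakk>
      \<Longrightarrow> \<exists>!\<mu>. \<mu> \<in> hom2 L x y \<and> \<mu> \<lhd> r = \<kappa>"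
proof -
  note cor = assms[unfolded is_coroot_iff]
  show "\<pi> \<in> hom2 L (Zero L A B) (Zero L A B)" "r \<in> hom1 L B (Cod L r)"
    "r \<rhd> \<pi> = Id2 L (Zero L A (Cod L r))"
    using cor by (simp_all add: hom1_def)
  show "\<exists>y' \<in> hom1 L (Cod L r) Y. \<exists>\<xi>. \<xi> \<in> hom2 L y (y' \<cdot> r)"
    if "y \<in> hom1 L B Y" "y \<rhd> \<pi> = Id2 L (Zero L A Y)"
    using cor that hom1_Cod_Obj[OF that(1)] by blast
  show "\<exists>!\<mu>. \<mu> \<in> hom2 L x y \<and> \<mu> \<lhd> r = \<kappa>"
    if "x \<in> hom1 L (Cod L r) Y" "y \<in> hom1 L (Cod L r) Y" "\<kappa> \<in> hom2 L (x \<cdot> r) (y \<cdot> r)"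
    using cor that hom1_Cod_Obj[OF that(1)] by simp
qed

text \<open>This is unique lifting of cells along r with zero as target, because zero composed with
  r is zero.\<close>

lemma is_coroot_fully_zero_cofaithful:
  assumes "is_coroot L A B \<pi> r" shows "fully_zero_cofaithful L r"
proof -
  note r = is_corootD[OF assms]
  note [simp] = hom1_Dom[OF r(2)]
  show ?thesis
    unfolding fully_zero_cofaithful_iff
  proof (intro ballI)
    fix Y b \<beta> assume Y: "Y \<in> Obj L" and b: "b \<in> hom1 L (Cod L r) Y"
      and \<beta>: "\<beta> \<in> hom2 L (b \<cdot> r) (Zero L (Dom L r) Y)"
    show "\<exists>!\<alpha>. \<alpha> \<in> hom2 L b (Zero L (Cod L r) Y) \<and> \<alpha> \<lhd> r = \<beta>"
      using r(5)[OF b Zero_hom[OF hom1_Dom_Obj[OF b] Y], of \<beta>] \<beta> Zero_Comp[OF Y r(2)] by simp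
  qed
qed

text \<open>For b = 0 and \<beta> = 1 the identity already solves the lifting problem, so any other
  solution equals it.\<close>

lemma fully_zero_cofaithful_zero_cofaithful:
  assumes f: "f \<in> hom1 L A B" and full: "fully_zero_cofaithful L f" shows "zero_cofaithful L f"
  unfolding zero_cofaithful_iff
proof (intro ballI impI)
  note [simp] = hom1_Dom[OF f] hom1_Cod[OF f]
  fix Y \<alpha> assume Y: "Y \<in> Obj L" and \<alpha>: "\<alpha> \<in> hom2 L (Zero L (Cod L f) Y) (Zero L (Cod L f) Y)"
    and eq: "\<alpha> \<lhd> f = Id2 L (Zero L (Dom L f) Y)"
  note A = hom1_Dom_Obj[OF f] and B = hom1_Cod_Obj[OF f]
  note id = Id2_hom[OF hom1_Mor]
  have "\<exists>!\<alpha>. \<alpha> \<in> hom2 L (Zero L B Y) (Zero L B Y) \<and> \<alpha> \<lhd> f = Id2 L (Zero L A Y)"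
    using full[unfolded fully_zero_cofaithful_iff] Y Zero_hom[OF B Y] id[OF Zero_hom[OF A Y]]
      Zero_Comp[OF Y f] by simp
  moreover have "Id2 L (Zero L B Y) \<lhd> f = Id2 L (Zero L A Y)"
    using rwhisker_Id2[OF f Zero_hom[OF B Y]] Zero_Comp[OF Y f] by simp
  ultimately show "\<alpha> = Id2 L (Zero L (Cod L f) Y)"
    using \<alpha> eq id[OF Zero_hom[OF B Y]] by auto
qed

lemma fully_zero_cofaithful_comp:
  assumes e: "e \<in> hom1 L A B" and q: "q \<in> hom1 L B C"
    and fe: "fully_zero_cofaithful L e" and fq: "fully_zero_cofaithful L q"
  shows "fully_zero_cofaithful L (q \<cdot> e)"
  unfolding fully_zero_cofaithful_iff
proof (intro ballI)
  note qe = Comp_hom[OF e q]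
  note [simp] = hom1_Dom[OF e] hom1_Cod[OF e] hom1_Dom[OF q] hom1_Cod[OF q]
    hom1_Dom[OF qe] hom1_Cod[OF qe]
  note B = hom1_Cod_Obj[OF e] and C = hom1_Cod_Obj[OF q]
  fix Y b \<beta> assume Y: "Y \<in> Obj L" and "b \<in> hom1 L (Cod L (q \<cdot> e)) Y"
    and "\<beta> \<in> hom2 L (b \<cdot> (q \<cdot> e)) (Zero L (Dom L (q \<cdot> e)) Y)"
  then have b: "b \<in> hom1 L C Y" and \<beta>: "\<beta> \<in> hom2 L ((b \<cdot> q) \<cdot> e) (Zero L A Y)"
    using Comp_assoc[OF e q] by auto
  have bq: "b \<cdot> q \<in> hom1 L B Y" using q b by (rule Comp_hom)
  have "\<exists>!\<nu>. \<nu> \<in> hom2 L (b \<cdot> q) (Zero L B Y) \<and> \<nu> \<lhd> e = \<beta>"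
    using fe[unfolded fully_zero_cofaithful_iff] Y bq \<beta> by simp
  then obtain \<nu> where \<nu>: "\<nu> \<in> hom2 L (b \<cdot> q) (Zero L B Y)" "\<nu> \<lhd> e = \<beta>"
    and \<nu>_unique: "\<And>\<nu>'. \<lbrakk>\<nu>' \<in> hom2 L (b \<cdot> q) (Zero L B Y); \<nu>' \<lhd> e = \<beta>\<rbrakk> \<Longrightarrow> \<nu>' = \<nu>"
    by blast
  have ex1: "\<exists>!\<alpha>. \<alpha> \<in> hom2 L b (Zero L C Y) \<and> \<alpha> \<lhd> q = \<nu>"
    using fq[unfolded fully_zero_cofaithful_iff] Y b \<nu>(1) by simp
  \<comment> \<open>As \<nu> is the only lift of \<beta> along e, lifting \<beta> along
    \<open>q \<cdot> e\<close> amounts to lifting \<nu> along q.\<close>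
  have "\<alpha> \<lhd> q = \<nu> \<longleftrightarrow> \<alpha> \<lhd> (q \<cdot> e) = \<beta>" if \<alpha>: "\<alpha> \<in> hom2 L b (Zero L C Y)" for \<alpha>
    using rwhisker_rwhisker[OF e q b \<alpha>] rwhisker_hom[OF q b \<alpha>] Zero_Comp[OF Y q] \<nu>(2)
      \<nu>_unique[of "\<alpha> \<lhd> q"] by auto
  then show "\<exists>!\<alpha>. \<alpha> \<in> hom2 L b (Zero L (Cod L (q \<cdot> e)) Y) \<and> \<alpha> \<lhd> (q \<cdot> e) = \<beta>"
    using ex1 by (metis hom1_Cod[OF qe])
qed

end

section \<open>Factorization in a 2-Puppe-exact category\<close>

context two_puppe_exact
begin

lemma coroot_of_pip_factor_zero_faithful:
  assumes f: "f \<in> hom1 L A B" and pip: "is_pip L f P \<pi>" and cor: "is_coroot L P A \<pi> e"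
    and m: "m \<in> hom1 L (Cod L e) B" and \<xi>: "\<xi> \<in> hom2 L f (m \<cdot> e)"
  shows "zero_faithful L m"
  unfolding zero_faithful_def
proof (intro ballI impI)
  define I where "I = Cod L e"
  note [simp] = hom1_Dom[OF f] hom1_Cod[OF f]
  note e = is_corootD[OF cor, folded I_def]
  have m: "m \<in> hom1 L I B" using m by (simp add: I_def)
  note [simp] = hom1_Dom[OF m] hom1_Cod[OF m]
  have A: "A \<in> Obj L" and B: "B \<in> Obj L" and I: "I \<in> Obj L"
    using f m hom1_Dom_Obj hom1_Cod_Obj by blast+
  fix X \<mu> assume X: "X \<in> Obj L" and "\<mu> \<in> hom2 L (Zero L X (Dom L m)) (Zero L X (Dom L m))"
    and "m \<rhd> \<mu> = Id2 L (Zero L X (Cod L m))"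
  then have \<mu>: "\<mu> \<in> hom2 L (Zero L X I) (Zero L X I)" and m\<mu>: "m \<rhd> \<mu> = Id2 L (Zero L X B)"
    by simp_all
  obtain q where corq: "is_coroot L X I \<mu> q"
    using zero_object_exists coroot_exists[OF _ has_2cokernels X I \<mu>] by blast
  define J where "J = Cod L q"
  note q = is_corootD[OF corq, folded J_def]
  have J: "J \<in> Obj L" using q(2) by (rule hom1_Cod_Obj)
  obtain m' \<phi> where m': "m' \<in> hom1 L J B" and \<phi>: "\<phi> \<in> hom2 L m (m' \<cdot> q)"
    using q(4)[OF m m\<mu>] by blast
  note qe = Comp_hom[OF e(2) q(2)]
  note [simp] = hom1_Dom[OF qe] hom1_Cod[OF qe]
  have \<xi>': "(\<phi> \<lhd> e) \<bullet> \<xi> \<in> hom2 L f (m' \<cdot> (q \<cdot> e))"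
    using VComp_hom[OF \<xi> rwhisker_hom[OF e(2) m \<phi>]] Comp_assoc[OF e(2) q(2) m'] by simp
  \<comment> \<open>Forward: \<alpha> factors through the pip \<pi>, which e kills. Backward: f is
    isomorphic to \<open>m' \<cdot> (q \<cdot> e)\<close> by \<open>\<xi>'\<close>.\<close>
  have kill: "f \<rhd> \<alpha> = Id2 L (Zero L Y B) \<longleftrightarrow> (q \<cdot> e) \<rhd> \<alpha> = Id2 L (Zero L Y J)"
    if Y: "Y \<in> Obj L" and \<alpha>: "\<alpha> \<in> hom2 L (Zero L Y A) (Zero L Y A)" for Y \<alpha>
  proof
    assume "f \<rhd> \<alpha> = Id2 L (Zero L Y B)"
    then obtain x where x: "x \<in> hom1 L Y P" and \<alpha>x: "\<alpha> = \<pi> \<lhd> x"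
      using pip Y \<alpha> unfolding is_pip_def by auto
    have P: "P \<in> Obj L" using x by (rule hom1_Cod_Obj)
    have "e \<rhd> \<alpha> = Id2 L (Zero L Y I)"
      using lwhisker_rwhisker[OF x Zero_hom[OF P A] e(2) e(1)] e(3)
        rwhisker_Id2[OF x Zero_hom[OF P I]] Zero_Comp[OF I x] \<alpha>x by simp
    then show "(q \<cdot> e) \<rhd> \<alpha> = Id2 L (Zero L Y J)"
      using lwhisker_lwhisker[OF Zero_hom[OF Y A] e(2) q(2) \<alpha>]
        lwhisker_Id2[OF Zero_hom[OF Y I] q(2)] Comp_Zero[OF Y q(2)] by simp
  next
    assume "(q \<cdot> e) \<rhd> \<alpha> = Id2 L (Zero L Y J)"
    then show "f \<rhd> \<alpha> = Id2 L (Zero L Y B)"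
      using lwhisker_cong[OF Y f \<xi>' \<alpha>] lwhisker_lwhisker[OF Zero_hom[OF Y A] qe m' \<alpha>]
        lwhisker_Id2[OF Zero_hom[OF Y J] m'] Comp_Zero[OF Y m'] by simp
  qed
  \<comment> \<open>Being a pip depends on the morphism only through its domain and the cells it
    kills, and f and \<open>q \<cdot> e\<close> share both.\<close>
  have "is_pip L (q \<cdot> e) P \<pi>"
    using pip hom1_Mor[OF qe] kill kill[of P \<pi>] unfolding is_pip_def by simp
  moreover have "fully_zero_cofaithful L (q \<cdot> e)"
    using fully_zero_cofaithful_comp[OF e(2) q(2)] is_coroot_fully_zero_cofaithful cor corq by blast
  ultimately have "is_coroot L P A \<pi> (q \<cdot> e)"
    using fully_zero_cofaithful_coroot[OF hom1_Mor[OF qe]] by (simp add: is_coroot_of_its_pip_def)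
  \<comment> \<open>Since e kills \<pi>, it factors up to isomorphism through the coroot
    \<open>q \<cdot> e\<close>.\<close>
  from is_corootD(4)[OF this e(2) e(3)]
  obtain r \<zeta> where r: "r \<in> hom1 L J I" and \<zeta>: "\<zeta> \<in> hom2 L e (r \<cdot> (q \<cdot> e))" by auto
  note rq = Comp_hom[OF q(2) r] and id = Id1_hom[OF I]
  have "\<zeta> \<in> hom2 L (Id1 L I \<cdot> e) ((r \<cdot> q) \<cdot> e)"
    using \<zeta> Id1_Comp[OF e(2)] Comp_assoc[OF e(2) q(2) r] by simp
  \<comment> \<open>The coroot e lets cells be cancelled on the right: \<zeta> is the whiskering
    with e of a unique \<nu>.\<close>
  then obtain \<nu> where \<nu>: "\<nu> \<in> hom2 L (Id1 L I) (r \<cdot> q)"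
    using e(5)[OF id rq] by blast
  have "\<mu> = (r \<cdot> q) \<rhd> \<mu>"
    using Id1_lwhisker[OF Zero_hom[OF X I] \<mu>] lwhisker_cong[OF X id \<nu> \<mu>] by simp
  also have "\<dots> = Id2 L (Zero L X I)"
    using lwhisker_lwhisker[OF Zero_hom[OF X I] q(2) r \<mu>] q(3)
      lwhisker_Id2[OF Zero_hom[OF X J] r] Comp_Zero[OF X r] by simp
  finally show "\<mu> = Id2 L (Zero L X (Dom L m))" by simp
qed

text \<open>The exactness axiom speaks of an arbitrary 2-kernel of e; \<open>has_2kernels\<close>
  supplies one, and e is its 2-cokernel.\<close>

lemma is_2cokernel_if_zero_cofaithful:
  assumes "e \<in> Mor L" "zero_cofaithful L e" shows "\<exists>g \<beta>. is_2cokernel L g e \<beta>"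
  using assms zero_cofaithful_2cokernel has_2kernels
  unfolding is_2cokernel_of_its_2kernel_def has_2kernels_def by blast

lemma is_2kernel_if_zero_faithful:
  assumes "m \<in> Mor L" "zero_faithful L m" shows "\<exists>h \<alpha>. is_2kernel L h m \<alpha>"
  using assms zero_faithful_2kernel has_2cokernels
  unfolding is_2kernel_of_its_2cokernel_def has_2cokernels_def by blast

lemma factorization:
  assumes "f \<in> Mor L"
  shows "\<exists>e m \<iota>. e \<in> Mor L \<and> m \<in> Mor L \<and> Cod L e = Dom L m \<and> \<iota> \<in> hom2 L f (m \<cdot> e) \<and>
      (\<exists>g \<beta>. is_2cokernel L g e \<beta>) \<and> (\<exists>h \<alpha>. is_2kernel L h m \<alpha>)"
proof -
  define A B where "A = Dom L f" and "B = Cod L f"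
  have f: "f \<in> hom1 L A B" using Mor_hom1[OF assms] by (simp add: A_def B_def)
  note A = hom1_Dom_Obj[OF f]
  obtain Z where Z: "zero_object L Z" using zero_object_exists by blast
  obtain P \<pi> where pip: "is_pip L f P \<pi>" using pip_exists[OF Z has_2kernels f] by blast
  then have P: "P \<in> Obj L" and \<pi>: "\<pi> \<in> hom2 L (Zero L P A) (Zero L P A)"
    and f\<pi>: "f \<rhd> \<pi> = Id2 L (Zero L P B)"
    unfolding is_pip_def A_def B_def by blast+
  obtain e where cor: "is_coroot L P A \<pi> e" using coroot_exists[OF Z has_2cokernels P A \<pi>] by blast
  note e = is_corootD[OF cor]
  \<comment> \<open>f kills its own pip \<pi>, so the coroot property of e applies to f.\<close>
  obtain m \<xi> where m: "m \<in> hom1 L (Cod L e) B" and \<xi>: "\<xi> \<in> hom2 L f (m \<cdot> e)"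
    using e(4)[OF f f\<pi>] by blast
  have "zero_cofaithful L e"
    using fully_zero_cofaithful_zero_cofaithful[OF e(2)] is_coroot_fully_zero_cofaithful[OF cor] .
  moreover have "zero_faithful L m"
    using coroot_of_pip_factor_zero_faithful[OF f pip cor m \<xi>] .
  ultimately show ?thesis
    using hom1_Mor[OF e(2)] hom1_Mor[OF m] hom1_Dom[OF m] \<xi>
      is_2cokernel_if_zero_cofaithful is_2kernel_if_zero_faithful by metis
qed

end

theorem theorem4p21:
  fixes L :: "('o, 'm, 'c) pointed_two_cat"
  assumes "two_puppe_exact L"
  shows "weakly_puppe_two_exact L"
proof -
  interpret two_puppe_exact L by fact
  show ?thesis
  proof
    show "has_2kernels L" "has_2cokernels L" "zero_ideal_weakly_closed L"
      by (fact has_2kernels has_2cokernels zero_ideal_weakly_closed)+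
  next
    fix f k \<alpha> assume k: "is_2kernel L f k \<alpha>"
    then show "is_2kernel_of_its_2cokernel L k"
      using zero_faithful_2kernel[OF _ is_2kernel_zero_faithful] by (auto simp: is_2kernel_def)
  next
    fix f c \<beta> assume c: "is_2cokernel L f c \<beta>"
    \<comment> \<open>In \<open>op_cat L\<close> the 2-cokernel c is a 2-kernel, hence 0-faithful
      there.\<close>
    then have "zero_cofaithful L c"
      using gpd_star_category.is_2kernel_zero_faithful[OF op_gpd_star_category]
      by (simp add: is_2cokernel_def zero_cofaithful_def)
    then show "is_2cokernel_of_its_2kernel L c"
      using c zero_cofaithful_2cokernel by (auto simp: is_2cokernel_iff)
  qed (rule factorization)
qed

end
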